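(* Let $m,n,s,t$ be positive integers and let $G$ be an $(s,t)$-biregular graph of biorder $(m,n)$. Suppose that $G$ has a rotation $\rho$ giving a monofacial embedding, and a unique-current assignment $\kappa$ with currents in $\mathbb{Z}_{2ms+1}$ satisfying Kirchhoff's Current Law. Then there is a cellular embedding of $K_{2ms+1}$ in an orientable surface such that each edge lies on a face of size $s$ and a face of size $t$. Moreover, if each local rotation of $\rho$ is simple with respect to $\kappa$, then the faces of this embedding of $K_{2ms+1}$ are simple cycles.
   Context: An $(s,t)$-biregular graph of biorder $(m,n)$ is a bipartite graph with one part consisting of $m$ vertices of degree $s$ and the other part consisting of $n$ vertices of degree $t$. For a graph $G$, each edge $e$ has two directions $e^+,e^-$; $D(G)$ is the set of directed edges, $\tau$ the involution swapping $e^+$ and $e^-$, and $D_v$ the set of directed edges leaving $v$. A rotation $\rho$ is a permutation of $D(G)$ whose restriction to each $D_v$ is a cyclic permutation (the local rotation $\rho_v$); it determines a cellular embedding of $G$ in an orientable surface whose faces correspond to the orbits of $\rho\circ\tau$. The embedding is monofacial if $\rho\circ\tau$ has a single orbit. A current assignment with currents in $\mathbb{Z}_N$ is a map $\kappa:D(G)\to\mathbb{Z}_N$ with $\kappa(e^-)=-\kappa(e^+)$. It satisfies Kirchhoff's Current Law if $\sum_{e\in D_v}\kappa(e)\equiv 0 \pmod N$ for every vertex $v$, and is a unique-current assignment if $\kappa$ is a bijection from $D(G)$ to $\mathbb{Z}_N\setminus\{0\}$. A local rotation $\rho_v=(e_1,\dots,e_k)$ is simple with respect to $\kappa$ if the partial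 sums $\sum_{j=1}^i\kappa(e_j)$, $i=1,\dots,k$, are pairwise distinct. The size of a face is the length of its boundary walk. *)

theory Defs
  imports
    "Graph_Theory.Graph_Theory"
    "HOL-Combinatorics.Orbits"
    "HOL-Number_Theory.Cong"
begin

text \<open>
  A graph is a finite bidirected digraph: its arcs are the directed edges \<open>D(G)\<close>, and the
  fixpoint-free (on arcs) involution \<open>\<tau>\<close> sends \<open>e\<^sup>+\<close> to \<open>e\<^sup>-\<close>, so an undirected edge is a pair
  \<open>{e, \<tau> e}\<close>. The set \<open>D\<^sub>v\<close> is \<^const>\<open>out_arcs\<close> \<open>G v\<close>, and the degree of \<open>v\<close> is
  \<^const>\<open>out_degree\<close> \<open>G v\<close>. Parallel edges are not excluded.
\<close>

definition biregular ::
    "nat \<Rightarrow> nat \<Rightarrow> nat \<Rightarrow> nat \<Rightarrow> ('a, 'b) pre_digraph \<Rightarrow> bool" where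
  "biregular s t m n G \<longleftrightarrow>
    (\<exists>X Y. verts G = X \<union> Y \<and> X \<inter> Y = {} \<and>
       (\<forall>e \<in> arcs G. tail G e \<in> X \<longleftrightarrow> head G e \<in> Y) \<and>
       card X = m \<and> (\<forall>x \<in> X. out_degree G x = s) \<and>
       card Y = n \<and> (\<forall>y \<in> Y. out_degree G y = t))"

text \<open>
  A rotation \<open>\<rho>\<close> of a connected graph stands for the cellular embedding in a closed orientable surface
  obtained by gluing a disc to each orbit of \<open>\<rho> \<circ> \<tau>\<close>; by the Heffter--Edmonds principle every such
  embedding arises this way. A monofacial embedding forces connectedness up to isolated vertices.
  The guard below only exempts isolated vertices, whose local rotation is empty.
\<close>

locale rotation_system = fin_digraph G + bidirected_digraph G \<tau>
  for G :: "('a, 'b) pre_digraph" and \<tau> :: "'b \<Rightarrow> 'b" +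
  fixes \<rho> :: "'b \<Rightarrow> 'b"
  assumes rotation_permutes: "\<rho> permutes arcs G"
    and rotation_cyclic:
      "\<And>v. v \<in> verts G \<Longrightarrow> out_arcs G v \<noteq> {} \<Longrightarrow> cyclic_on \<rho> (out_arcs G v)"

definition faces :: "('a, 'b) pre_digraph \<Rightarrow> ('b \<Rightarrow> 'b) \<Rightarrow> ('b \<Rightarrow> 'b) \<Rightarrow> 'b set set" where
  "faces G \<tau> \<rho> = orbit (\<rho> \<circ> \<tau>) ` arcs G"

definition monofacial :: "('a, 'b) pre_digraph \<Rightarrow> ('b \<Rightarrow> 'b) \<Rightarrow> ('b \<Rightarrow> 'b) \<Rightarrow> bool" where
  "monofacial G \<tau> \<rho> \<longleftrightarrow> card (faces G \<tau> \<rho>) = 1"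

text \<open>
  The boundary walk of the face containing the directed edge \<open>e\<close>, read from \<open>e\<close>. It traverses each
  directed edge of the orbit exactly once, so the size of a face \<open>F\<close> is \<open>card F\<close>.
\<close>

definition boundary_walk :: "('b \<Rightarrow> 'b) \<Rightarrow> ('b \<Rightarrow> 'b) \<Rightarrow> 'b \<Rightarrow> 'b list" where
  "boundary_walk \<tau> \<rho> e =
     map (\<lambda>i. ((\<rho> \<circ> \<tau>) ^^ i) e) [0..<card (orbit (\<rho> \<circ> \<tau>) e)]"

text \<open>The edge \<open>{e, \<tau> e}\<close> lies on \<open>F\<close> if the boundary walk of \<open>F\<close> uses it in some direction.\<close>

definition edge_on_face :: "('b \<Rightarrow> 'b) \<Rightarrow> 'b \<Rightarrow> 'b set \<Rightarrow> bool" where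
  "edge_on_face \<tau> e F \<longleftrightarrow> e \<in> F \<or> \<tau> e \<in> F"

text \<open>
  The bound on the length is needed because \<^const>\<open>pre_digraph.cycle\<close> admits a walk going
  back and forth along one edge.
\<close>

definition faces_simple_cycles ::
    "('a, 'b) pre_digraph \<Rightarrow> ('b \<Rightarrow> 'b) \<Rightarrow> ('b \<Rightarrow> 'b) \<Rightarrow> bool" where
  "faces_simple_cycles G \<tau> \<rho> \<longleftrightarrow>
    (\<forall>e \<in> arcs G. pre_digraph.cycle G (boundary_walk \<tau> \<rho> e) \<and>
       3 \<le> length (boundary_walk \<tau> \<rho> e))"

text \<open>Elements of \<open>\<int>\<^sub>N\<close> are represented by their residues in \<open>{0..<N}\<close>.\<close>

definition current_assignment ::
    "nat \<Rightarrow> ('a, 'b) pre_digraph \<Rightarrow> ('b \<Rightarrow> 'b) \<Rightarrow> ('b \<Rightarrow> int) \<Rightarrow> bool" where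
  "current_assignment N G \<tau> \<kappa> \<longleftrightarrow>
    (\<forall>e \<in> arcs G. \<kappa> e \<in> {0..<int N} \<and> [\<kappa> (\<tau> e) = - \<kappa> e] (mod int N))"

definition kirchhoff_current_law ::
    "nat \<Rightarrow> ('a, 'b) pre_digraph \<Rightarrow> ('b \<Rightarrow> int) \<Rightarrow> bool" where
  "kirchhoff_current_law N G \<kappa> \<longleftrightarrow>
    (\<forall>v \<in> verts G. [(\<Sum>e \<in> out_arcs G v. \<kappa> e) = 0] (mod int N))"

definition unique_current_assignment ::
    "nat \<Rightarrow> ('a, 'b) pre_digraph \<Rightarrow> ('b \<Rightarrow> 'b) \<Rightarrow> ('b \<Rightarrow> int) \<Rightarrow> bool" where
  "unique_current_assignment N G \<tau> \<kappa> \<longleftrightarrow>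
    current_assignment N G \<tau> \<kappa> \<and> bij_betw \<kappa> (arcs G) ({0..<int N} - {0})"

text \<open>
  The local rotation at \<open>v\<close> is \<open>(e, \<rho> e, \<rho>\<^sup>2 e, \<dots>)\<close> for any choice of a first element \<open>e\<close>. Under
  Kirchhoff's Current Law, whether the partial sums are distinct does not depend on this choice.
\<close>

definition simple_local_rotation ::
    "nat \<Rightarrow> ('a, 'b) pre_digraph \<Rightarrow> ('b \<Rightarrow> 'b) \<Rightarrow> ('b \<Rightarrow> int) \<Rightarrow> 'a \<Rightarrow> bool" where
  "simple_local_rotation N G \<rho> \<kappa> v \<longleftrightarrow>
    (\<exists>e \<in> out_arcs G v.
       inj_on (\<lambda>i. (\<Sum>j<i. \<kappa> ((\<rho> ^^ j) e)) mod int N) {1..out_degree G v})"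

end

theory Submission
  imports Defs
begin

text \<open>
  Label the arc \<open>(u, u + \<kappa> e)\<close> of the complete digraph on \<open>\<int>\<^sub>N\<close> by \<open>e\<close>; as \<open>\<kappa>\<close> is a bijection onto the
  nonzero residues, each arc leaving \<open>u\<close> gets exactly one label. Let the local rotation at every vertex
  read off the labels along the single face of \<open>G\<close>. Tracing a face of the resulting embedding, an arc
  with label \<open>e\<close> is followed by one with label \<open>\<rho> (\<tau> (\<tau> e)) = \<rho> e\<close>, so the labels run
  through one local rotation \<open>\<rho>\<^sub>v\<close>, and by Kirchhoff's law the walk closes up after exactly one turn. The
  vertices it visits are translates of the partial sums of \<open>\<rho>\<^sub>v\<close>. An edge with labels \<open>e\<close> and \<open>\<tau> e\<close> lies
  on a face for each end of \<open>e\<close>.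
\<close>

section \<open>Iterating a cyclic permutation, and walks obtained by iteration\<close>

lemma cyclic_on_funpow_card:
  assumes "cyclic_on f S" "x \<in> S"
  shows "(f ^^ card S) x = x"
    and "inj_on (\<lambda>i. (f ^^ i) x) {..<card S}"
    and "(\<lambda>i. (f ^^ i) x) ` {..<card S} = S"
proof -
  have S: "orbit f x = S" using orbit_cyclic_eq3[OF assms] .
  with assms have self: "x \<in> orbit f x" by simp
  let ?d = "funpow_dist1 f x x"
  have im: "S = (\<lambda>i. (f ^^ i) x) ` {0..<?d}"
    using orbit_conv_funpow_dist1[OF self] S by simp
  have inj: "inj_on (\<lambda>i. (f ^^ i) x) {0..<?d}"
    by (rule inj_on_funpow_dist1[OF self])
  have d: "card S = ?d"
    by (subst im) (simp only: card_image[OF inj] card_atLeastLessThan diff_zero)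
  show "(f ^^ card S) x = x" unfolding d by (rule funpow_dist1_prop[OF self])
  show "inj_on (\<lambda>i. (f ^^ i) x) {..<card S}" unfolding d using inj by (simp only: lessThan_atLeast0)
  show "(\<lambda>i. (f ^^ i) x) ` {..<card S} = S"
    unfolding d using im by (simp only: lessThan_atLeast0)
qed

text \<open>Any map that sends an arc to one starting at its head traces a walk under iteration.
  Applied to the face permutation, this shows that boundary walks are walks.\<close>

lemma (in wf_digraph) awalk_map_funpow:
  assumes "\<And>e. e \<in> arcs G \<Longrightarrow> f e \<in> arcs G \<and> tail G (f e) = head G e"
    and "e \<in> arcs G"
  shows "awalk (tail G e) (map (\<lambda>i. (f ^^ i) e) [0..<k]) (tail G ((f ^^ k) e))"
proof -
  have arc: "(f ^^ i) e \<in> arcs G" for i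
    using assms by (induction i) auto
  show ?thesis
  proof (induction k)
    case 0
    then show ?case using assms by (simp add: awalk_Nil_iff)
  next
    case (Suc k)
    have "awalk (tail G ((f ^^ k) e)) [(f ^^ k) e] (tail G ((f ^^ Suc k) e))"
      using arc[of k] assms(1)[OF arc[of k]] by (simp add: awalk_def)
    with Suc show ?case by (simp add: awalk_appendI del: awalk_append_iff)
  qed
qed

section \<open>The embedding derived from a current graph\<close>

locale current_graph = rotation_system G \<tau> \<rho>
  for G :: "('a, 'b) pre_digraph" and \<tau> \<rho> :: "'b \<Rightarrow> 'b" +
  fixes N :: nat and \<kappa> :: "'b \<Rightarrow> int"
  assumes cyclic_face: "cyclic_on (\<rho> \<circ> \<tau>) (arcs G)"
    and unique_current: "unique_current_assignment N G \<tau> \<kappa>"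
    and KCL: "kirchhoff_current_law N G \<kappa>"
begin

text \<open>Translation in \<int>_N across two types: vertices are naturals below \<open>N\<close>,
  currents are integers.\<close>

definition shift :: "nat \<Rightarrow> int \<Rightarrow> nat" where
  "shift u a = nat ((int u + a) mod int N)"

text \<open>The arc leaving \<open>u\<close> with generator \<open>\<kappa> e\<close> in the Cayley
  graph of \<int>_N. All nonzero residues occur as generators, so this Cayley graph is
  complete.\<close>

definition lift :: "nat \<Rightarrow> 'b \<Rightarrow> nat \<times> nat" where
  "lift u e = (u, shift u (\<kappa> e))"

text \<open>Arcs are stored as bare pairs, which makes completeness immediate; the label is
  therefore recovered by inverting \<open>\<kappa>\<close> on the difference of the ends.\<close>

definition label :: "nat \<times> nat \<Rightarrow> 'b" where
  "label p = inv_into (arcs G) \<kappa> ((int (snd p) - int (fst p)) mod int N)"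

definition derived :: "(nat, nat \<times> nat) pre_digraph" where
  "derived = \<lparr>verts = {..<N}, arcs = {(u, v). u < N \<and> v < N \<and> u \<noteq> v}, tail = fst, head = snd\<rparr>"

text \<open>Reversal in a bidirected digraph has to fix everything that is not an arc, hence the
  restriction. The same holds for \<open>derived_rot\<close>, which has to permute the arcs in the
  sense of \<open>permutes\<close>.\<close>

definition derived_rev :: "nat \<times> nat \<Rightarrow> nat \<times> nat" where
  "derived_rev = perm_restrict prod.swap (arcs derived)"

definition derived_rot :: "nat \<times> nat \<Rightarrow> nat \<times> nat" where
  "derived_rot = perm_restrict (\<lambda>p. lift (fst p) (\<rho> (\<tau> (label p)))) (arcs derived)"

abbreviation derived_face :: "nat \<times> nat \<Rightarrow> nat \<times> nat" where
  "derived_face \<equiv> derived_rot \<circ> derived_rev"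

lemma derived_simps [simp]:
  "verts derived = {..<N}" "tail derived = fst" "head derived = snd"
  "(u, v) \<in> arcs derived \<longleftrightarrow> u < N \<and> v < N \<and> u \<noteq> v"
  by (simp_all add: derived_def)

section \<open>Arithmetic of shifts and basic facts on currents\<close>

lemma shift_shift: "shift (shift u a) b = shift u (a + b)" if "u < N"
  using that by (simp add: shift_def mod_simps add.assoc)

lemma shift_less: "shift u a < N" if "u < N"
proof -
  have "(int u + a) mod int N < int N" using that by simp
  moreover have "0 \<le> (int u + a) mod int N" using that by simp
  ultimately show ?thesis unfolding shift_def by linarith
qed

lemma shift_eq_iff: "shift u a = shift u b \<longleftrightarrow> [a = b] (mod int N)" if "u < N"
proof -
  have "shift u a = shift u b \<longleftrightarrow> [int u + a = int u + b] (mod int N)"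
    using that by (simp add: shift_def cong_def eq_nat_nat_iff)
  also have "\<dots> \<longleftrightarrow> [a = b] (mod int N)" by (rule cong_add_lcancel)
  finally show ?thesis .
qed

lemma shift_0 [simp]: "shift u 0 = u" if "u < N"
  using that by (simp add: shift_def)

lemma current_range: "\<kappa> e \<in> {0..<int N} - {0}" if "e \<in> arcs G"
  using unique_current that unfolding unique_current_assignment_def bij_betw_def by blast

lemma inj_current: "inj_on \<kappa> (arcs G)"
  using unique_current unfolding unique_current_assignment_def bij_betw_def by blast

lemma current_surj: "\<exists>e\<in>arcs G. \<kappa> e = a" if "a \<in> {0..<int N} - {0}"
  using unique_current that unfolding unique_current_assignment_def bij_betw_def
  by (metis imageE)

lemma current_rev: "[\<kappa> (\<tau> e) = - \<kappa> e] (mod int N)" if "e \<in> arcs G"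
  using unique_current that unfolding unique_current_assignment_def current_assignment_def by blast

lemma rotation_in_arcs [simp]: "\<rho> e \<in> arcs G \<longleftrightarrow> e \<in> arcs G"
  using rotation_permutes by (rule permutes_in_image)

lemma funpow_rotation_in_arcs [simp]: "(\<rho> ^^ i) e \<in> arcs G \<longleftrightarrow> e \<in> arcs G"
  by (induction i) auto

lemma cyclic_out_arcs: "cyclic_on \<rho> (out_arcs G (tail G e))" if "e \<in> arcs G"
  using that by (intro rotation_cyclic) (auto simp: out_arcs_def)

lemma tail_rotation [simp]: "tail G (\<rho> e) = tail G e" if "e \<in> arcs G"
  using cyclic_on_inI[OF cyclic_out_arcs[OF that], of e] that by simp

section \<open>Correspondence between arcs of the complete digraph and lifts\<close>

lemma label_lift: "label (lift u e) = e" if "u < N" "e \<in> arcs G"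
proof -
  have "(int (shift u (\<kappa> e)) - int u) mod int N = \<kappa> e"
    using that current_range[OF that(2)] by (simp add: shift_def mod_simps)
  then show ?thesis
    using that inj_current by (simp add: label_def lift_def inv_into_f_f)
qed

lemma lift_in_arcs: "lift u e \<in> arcs derived" if "u < N" "e \<in> arcs G"
proof -
  have "shift u (\<kappa> e) \<noteq> shift u 0"
    using that current_range[OF that(2)] by (simp add: shift_eq_iff cong_def del: shift_0)
  then show ?thesis using that by (simp add: lift_def shift_less)
qed

text \<open>The ends of an arc are distinct residues, so their difference is nonzero and, by
  surjectivity of \<open>\<kappa>\<close>, is the current of some arc of \<open>G\<close>.\<close>

lemma label_props: "label p \<in> arcs G" "lift (fst p) (label p) = p" if "p \<in> arcs derived"
proof -
  obtain u v where p: "p = (u, v)" by fastforce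
  with that have uv: "u < N" "v < N" "u \<noteq> v" by auto
  define a where "a = (int v - int u) mod int N"
  have "a \<noteq> 0"
  proof
    assume "a = 0"
    then have "[int v = int u] (mod int N)" by (simp add: a_def cong_iff_dvd_diff dvd_eq_mod_eq_0)
    then show False using uv by (simp add: cong_def)
  qed
  then have "a \<in> {0..<int N} - {0}" using uv by (simp add: a_def)
  then obtain e where e: "e \<in> arcs G" "\<kappa> e = a" using current_surj by blast
  have "lift u e = p"
    using uv by (simp add: lift_def shift_def e a_def p mod_simps)
  with label_lift[of u e] e uv p show "label p \<in> arcs G" "lift (fst p) (label p) = p"
    by auto
qed

lemma derived_arcE:
  assumes "p \<in> arcs derived"
  obtains u e where "u < N" "e \<in> arcs G" "p = lift u e"
proof
  show "fst p < N" using assms by (cases p) auto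
  show "label p \<in> arcs G" "p = lift (fst p) (label p)"
    using label_props[OF assms] by auto
qed

lemma out_arcs_derived: "out_arcs derived u = lift u ` arcs G" if "u < N"
proof
  show "out_arcs derived u \<subseteq> lift u ` arcs G"
    by (metis derived_simps(2) image_eqI in_out_arcs_conv label_props subsetI)
  show "lift u ` arcs G \<subseteq> out_arcs derived u"
    using that lift_in_arcs by (auto simp: lift_def)
qed

section \<open>Rotation, reversal and face tracing in terms of labels\<close>

lemma derived_rot_lift: "derived_rot (lift u e) = lift u (\<rho> (\<tau> e))" if "u < N" "e \<in> arcs G"
  using that lift_in_arcs[OF that] label_lift[OF that]
  by (simp add: derived_rot_def perm_restrict_def) (simp add: lift_def)

text \<open>Opposite directions carry opposite currents, so the lift of \<open>\<tau> e\<close> from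
  the head of \<open>lift u e\<close> leads back to \<open>u\<close>.\<close>

lemma derived_rev_lift: "derived_rev (lift u e) = lift (shift u (\<kappa> e)) (\<tau> e)"
  if "u < N" "e \<in> arcs G"
proof -
  have "shift u (\<kappa> e + \<kappa> (\<tau> e)) = shift u 0"
    using current_rev[OF that(2)] that
    by (subst shift_eq_iff) (auto simp: cong_iff_dvd_diff add.commute)
  then show ?thesis
    using that lift_in_arcs[OF that] by (simp add: derived_rev_def perm_restrict_def lift_def shift_shift)
qed

lemma derived_face_lift: "derived_face (lift u e) = lift (shift u (\<kappa> e)) (\<rho> e)"
  if "u < N" "e \<in> arcs G"
  using that by (simp add: derived_rev_lift derived_rot_lift shift_less)

lemma funpow_derived_face_lift:
  "(derived_face ^^ i) (lift u e) = lift (shift u (\<Sum>j<i. \<kappa> ((\<rho> ^^ j) e))) ((\<rho> ^^ i) e)"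
  if "u < N" "e \<in> arcs G"
proof (induction i)
  case 0
  then show ?case using that by simp
next
  case (Suc i)
  have "(derived_face ^^ Suc i) (lift u e) = derived_face ((derived_face ^^ i) (lift u e))"
    by simp
  also have "\<dots> = lift (shift u (\<Sum>j<Suc i. \<kappa> ((\<rho> ^^ j) e))) ((\<rho> ^^ Suc i) e)"
    unfolding Suc using that by (subst derived_face_lift) (auto simp: shift_less shift_shift)
  finally show ?case .
qed

section \<open>Completeness and the rotation system\<close>

lemma complete_derived: "complete_digraph N derived"
proof -
  have "finite (arcs derived)"
    by (rule finite_subset[of _ "{..<N} \<times> {..<N}"]) auto
  then interpret D: graph derived
    by unfold_locales (auto simp: symmetric_conv arc_to_ends_def Bex_def)
  show ?thesis
    unfolding complete_digraph_def by (auto simp: D.graph_axioms arcs_ends_conv)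
qed

text \<open>The map \<open>lift u\<close> carries \<open>\<rho> \<circ> \<tau>\<close> on the arcs
  of \<open>G\<close> to \<open>derived_rot\<close> on the arcs leaving \<open>u\<close>. Since the
  embedding of \<open>G\<close> has a single face, the former is cyclic, hence so is each local
  rotation.\<close>

lemma rotation_system_derived: "rotation_system derived derived_rev derived_rot"
proof -
  have fin: "finite (arcs derived)"
    by (rule finite_subset[of _ "{..<N} \<times> {..<N}"]) auto
  then interpret D: fin_digraph derived
    by unfold_locales auto
  interpret D: bidirected_digraph derived derived_rev
    by (rule D.bidirected_digraphI) (auto simp: derived_rev_def perm_restrict_def)
  have cyc: "cyclic_on derived_rot (out_arcs derived u)" if "u < N" for u
    unfolding out_arcs_derived[OF that]
    using cyclic_face by (rule cyclic_on_image) (simp add: derived_rot_lift that)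
  show ?thesis
  proof
    \<comment> \<open>Surjectivity comes first: every arc lies on its own orbit and so has a
      predecessor. Finiteness then yields injectivity.\<close>
    have "arcs derived \<subseteq> derived_rot ` arcs derived"
    proof
      fix p assume p: "p \<in> arcs derived"
      then have u: "fst p < N" and pu: "p \<in> out_arcs derived (fst p)" by (cases p, auto)+
      have "p \<in> orbit derived_rot p" using orbit_cyclic_eq3[OF cyc[OF u] pu] pu by simp
      then show "p \<in> derived_rot ` arcs derived"
      proof cases
        case base
        then show ?thesis using p by auto
      next
        case (step y)
        then have "y \<in> out_arcs derived (fst p)"
          using orbit_cyclic_eq3[OF cyc[OF u] pu] by simp
        with step show ?thesis by auto
      qed
    qed
    moreover have "derived_rot ` arcs derived \<subseteq> arcs derived"
      by (auto elim!: derived_arcE simp: derived_rot_lift lift_in_arcs)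
    ultimately have im: "derived_rot ` arcs derived = arcs derived" by blast
    then have "inj_on derived_rot (arcs derived)"
      by (simp add: eq_card_imp_inj_on fin)
    with im show "derived_rot permutes arcs derived"
      by (intro bij_imp_permutes) (auto simp: bij_betw_def derived_rot_def perm_restrict_def)
  qed (use cyc in auto)
qed

section \<open>Faces of the derived embedding and their sizes\<close>

lemma sum_local_rotation:
  "(\<Sum>j<out_degree G (tail G e). \<kappa> ((\<rho> ^^ j) e)) = (\<Sum>x\<in>out_arcs G (tail G e). \<kappa> x)"
  if "e \<in> arcs G"
proof -
  have "e \<in> out_arcs G (tail G e)" using that by simp
  note cyc = cyclic_on_funpow_card[OF cyclic_out_arcs[OF that] this]
  show ?thesis
    using sum.reindex[OF cyc(2), of \<kappa>] unfolding cyc(3) out_degree_def by simp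
qed

lemma derived_face_period:
  assumes "u < N" "e \<in> arcs G"
  shows "(derived_face ^^ out_degree G (tail G e)) (lift u e) = lift u e"
proof -
  have "[(\<Sum>j<out_degree G (tail G e). \<kappa> ((\<rho> ^^ j) e)) = 0] (mod int N)"
    using KCL assms(2) unfolding sum_local_rotation[OF assms(2)] kirchhoff_current_law_def by simp
  then have "shift u (\<Sum>j<out_degree G (tail G e). \<kappa> ((\<rho> ^^ j) e)) = shift u 0"
    using assms by (subst shift_eq_iff)
  moreover have "(\<rho> ^^ out_degree G (tail G e)) e = e"
    unfolding out_degree_def using assms
    by (intro cyclic_on_funpow_card(1) cyclic_out_arcs) auto
  ultimately show ?thesis
    using assms by (simp add: funpow_derived_face_lift)
qed

lemma out_degree_pos: "0 < out_degree G (tail G e)" if "e \<in> arcs G"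
proof -
  have "e \<in> out_arcs G (tail G e)" using that by simp
  then show ?thesis unfolding out_degree_def card_gt_0_iff by (metis empty_iff finite_out_arcs)
qed

lemma orbit_derived_face:
  assumes "u < N" "e \<in> arcs G"
  shows "orbit derived_face (lift u e) =
    (\<lambda>i. (derived_face ^^ i) (lift u e)) ` {..<out_degree G (tail G e)}"
  using orbit_altdef_bounded[OF derived_face_period[OF assms] out_degree_pos[OF assms(2)]] by auto

lemma label_funpow_derived_face:
  "label ((derived_face ^^ i) (lift u e)) = (\<rho> ^^ i) e" if "u < N" "e \<in> arcs G"
  using that by (simp add: funpow_derived_face_lift label_lift shift_less)

text \<open>The labels run through one local rotation without repetition, so the face cannot close
  up before a full turn. With \<open>derived_face_period\<close> this makes its size exactly the
  degree.\<close>

lemma inj_on_derived_face: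
  assumes "u < N" "e \<in> arcs G"
  shows "inj_on (\<lambda>i. (derived_face ^^ i) (lift u e)) {..<out_degree G (tail G e)}"
proof -
  have "inj_on (\<lambda>i. label ((derived_face ^^ i) (lift u e))) {..<out_degree G (tail G e)}"
    unfolding label_funpow_derived_face[OF assms] out_degree_def
    using assms by (intro cyclic_on_funpow_card(2) cyclic_out_arcs) auto
  then show ?thesis unfolding inj_on_def by metis
qed

lemma card_orbit_derived_face:
  "card (orbit derived_face (lift u e)) = out_degree G (tail G e)" if "u < N" "e \<in> arcs G"
  by (simp only: orbit_derived_face[OF that] card_image[OF inj_on_derived_face[OF that]] card_lessThan)

text \<open>An orbit starts with the first iterate, not the zeroth, so a positive period is what
  puts the arc on its own orbit.\<close>

lemma self_in_derived_face: "lift u e \<in> orbit derived_face (lift u e)" if "u < N" "e \<in> arcs G"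
  unfolding orbit_altdef using derived_face_period[OF that] out_degree_pos[OF that(2)]
  by (auto intro!: exI[of _ "out_degree G (tail G e)"])

text \<open>A face remembers the vertex of \<open>G\<close> whose local rotation it follows. This
  invariant separates the two faces at an edge.\<close>

lemma tail_label_orbit:
  assumes "u < N" "e \<in> arcs G" "p \<in> orbit derived_face (lift u e)"
  shows "tail G (label p) = tail G e"
proof -
  obtain i where "p = (derived_face ^^ i) (lift u e)"
    using assms(3) orbit_derived_face[OF assms(1,2)] by auto
  moreover have "tail G ((\<rho> ^^ i) e) = tail G e"
    using assms(2) by (induction i) auto
  ultimately show ?thesis using assms by (simp add: label_funpow_derived_face)
qed

text \<open>Here \<open>x\<close> is the label of \<open>e\<close>. The reversed arc has label
  \<open>\<tau> x\<close>, which leaves the head of \<open>x\<close>, so the two faces follow the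
  local rotations at the two ends of \<open>x\<close>.\<close>

lemma derived_faces_of_edge:
  assumes "e \<in> arcs derived"
  shows "\<exists>x\<in>arcs G. card (orbit derived_face e) = out_degree G (tail G x) \<and>
    card (orbit derived_face (derived_rev e)) = out_degree G (head G x) \<and>
    e \<in> orbit derived_face e \<and> derived_rev e \<in> orbit derived_face (derived_rev e) \<and>
    derived_rev e \<in> arcs derived \<and>
    (tail G x \<noteq> head G x \<longrightarrow> orbit derived_face e \<noteq> orbit derived_face (derived_rev e))"
proof -
  obtain u x where x: "u < N" "x \<in> arcs G" "e = lift u x"
    using assms by (rule derived_arcE)
  define v where "v = shift u (\<kappa> x)"
  have v: "v < N" "\<tau> x \<in> arcs G" "derived_rev e = lift v (\<tau> x)"
    using x by (auto simp: v_def shift_less derived_rev_lift)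
  have "tail G x = head G x" if "orbit derived_face e = orbit derived_face (derived_rev e)"
    using tail_label_orbit[OF v(1,2), of e] self_in_derived_face[OF x(1,2)] that x v
    by (simp add: label_lift)
  then show ?thesis
    using x v card_orbit_derived_face self_in_derived_face lift_in_arcs
    by (intro bexI[of _ x]) auto
qed

section \<open>Simplicity of the faces\<close>

lemma out_degree_ge_3:
  assumes "\<And>e. e \<in> arcs G \<Longrightarrow> tail G e \<noteq> head G e" and "e \<in> arcs G"
  shows "3 \<le> out_degree G (tail G e)"
\<comment> \<open>Kirchhoff's law at a vertex of degree one makes its current zero. At degree two
  the currents are opposite, so injectivity of \<open>\<kappa>\<close> forces the second arc to be
  \<open>\<tau> e\<close>, and \<open>e\<close> would be a loop.\<close>
proof (rule ccontr)
  let ?v = "tail G e"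
  assume "\<not> ?thesis"
  with out_degree_pos[OF assms(2)] have "out_degree G ?v = 1 \<or> out_degree G ?v = 2" by linarith
  moreover have "e \<in> out_arcs G ?v" using assms by simp
  ultimately consider "out_arcs G ?v = {e}" | x where "out_arcs G ?v = {e, x}" "x \<noteq> e"
  proof (elim disjE)
    assume "out_degree G ?v = 1"
    then obtain y where "out_arcs G ?v = {y}"
      unfolding out_degree_def by (rule card_1_singletonE)
    with \<open>e \<in> out_arcs G ?v\<close> that show ?thesis by auto
  next
    assume "out_degree G ?v = 2"
    then obtain y z where "out_arcs G ?v = {y, z}" "y \<noteq> z"
      unfolding out_degree_def by (auto simp: card_2_iff)
    with \<open>e \<in> out_arcs G ?v\<close> that show ?thesis by (metis doubleton_eq_iff insertE singletonD)
  qed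
  then show False
  proof cases
    case 1
    then have "[\<kappa> e = 0] (mod int N)"
      using KCL assms(2) tail_in_verts[OF assms(2)] unfolding kirchhoff_current_law_def by fastforce
    then show False using current_range[OF assms(2)] by (simp add: cong_def)
  next
    case 2
    then have x: "x \<in> arcs G" "tail G x = ?v" by auto
    have "[(\<Sum>y\<in>out_arcs G ?v. \<kappa> y) = 0] (mod int N)"
      using KCL tail_in_verts[OF assms(2)] unfolding kirchhoff_current_law_def by blast
    then have "[\<kappa> e + \<kappa> x = 0] (mod int N)"
      using 2 by simp
    then have "[\<kappa> x = - \<kappa> e] (mod int N)"
      by (simp add: cong_iff_dvd_diff add.commute)
    then have "[\<kappa> x = \<kappa> (\<tau> e)] (mod int N)"
      using current_rev[OF assms(2)] by (metis cong_sym cong_trans)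
    then have "\<kappa> x = \<kappa> (\<tau> e)"
      using current_range[OF x(1)] current_range[of "\<tau> e"] assms(2) by (simp add: cong_def)
    then have "x = \<tau> e"
      using inj_current x(1) assms(2) by (simp add: inj_on_eq_iff)
    then show False using x(2) assms(1)[OF assms(2)] assms(2) by simp
  qed
qed

lemma inj_on_snd_derived_face:
  assumes "u < N" "e \<in> arcs G" "simple_local_rotation N G \<rho> \<kappa> (tail G e)"
  shows "inj_on snd (orbit derived_face (lift u e))"
proof -
  let ?d = "out_degree G (tail G e)"
  obtain x where x: "x \<in> out_arcs G (tail G e)"
    and inj: "inj_on (\<lambda>i. (\<Sum>j<i. \<kappa> ((\<rho> ^^ j) x)) mod int N) {1..?d}"
    using assms(3) unfolding simple_local_rotation_def by blast
  obtain k where k: "x = (\<rho> ^^ k) e"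
    using cyclic_on_funpow_card(3)[OF cyclic_out_arcs[OF assms(2)], of e] x assms(2) by fastforce
  \<comment> \<open>Simplicity provides its own first element \<open>x\<close> of the local
    rotation. The vertex \<open>w\<close> is where the face through \<open>lift u e\<close> meets
    the arc labelled \<open>x\<close>; the face is read from there instead.\<close>
  define w where "w = shift u (\<Sum>j<k. \<kappa> ((\<rho> ^^ j) e))"
  have w: "w < N" "x \<in> arcs G" "tail G x = tail G e"
    using x assms by (auto simp: w_def shift_less)
  have "lift w x = (derived_face ^^ k) (lift u e)"
    using assms by (simp add: funpow_derived_face_lift w_def k)
  then have "lift w x \<in> orbit derived_face (lift u e)"
    using funpow_in_orbit[OF self_in_derived_face[OF assms(1,2)]] by simp
  then have orb: "orbit derived_face (lift u e) = orbit derived_face (lift w x)"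
    using self_in_derived_face[OF assms(1,2)]
    by (meson orbit_swap orbit_trans subsetI subset_antisym)
  \<comment> \<open>Heads rather than tails give sums of length \<open>Suc i\<close>, matching the
    index range starting at 1 in \<open>simple_local_rotation\<close>.\<close>
  have snd: "snd ((derived_face ^^ i) (lift w x)) = shift w (\<Sum>j<Suc i. \<kappa> ((\<rho> ^^ j) x))" for i
    using w by (simp add: funpow_derived_face_lift) (simp add: lift_def shift_shift)
  have "inj_on (\<lambda>i. snd ((derived_face ^^ i) (lift w x))) {..<?d}"
  proof (rule inj_onI)
    fix i k
    assume ik: "i \<in> {..<?d}" "k \<in> {..<?d}"
      and eq: "snd ((derived_face ^^ i) (lift w x)) = snd ((derived_face ^^ k) (lift w x))"
    from eq have "(\<Sum>j<Suc i. \<kappa> ((\<rho> ^^ j) x)) mod int N = (\<Sum>j<Suc k. \<kappa> ((\<rho> ^^ j) x)) mod int N"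
      unfolding snd shift_eq_iff[OF w(1)] cong_def .
    with inj have "Suc i = Suc k" by (rule inj_onD) (use ik in auto)
    then show "i = k" by simp
  qed
  then show ?thesis
    unfolding orb orbit_derived_face[OF w(1,2)] w(3) by (auto simp: inj_on_def)
qed

lemma derived_faces_simple_cycles:
  assumes "\<And>e. e \<in> arcs G \<Longrightarrow> tail G e \<noteq> head G e"
    and "\<And>v. v \<in> verts G \<Longrightarrow> simple_local_rotation N G \<rho> \<kappa> v"
  shows "faces_simple_cycles derived derived_rev derived_rot"
  unfolding faces_simple_cycles_def
proof
  interpret D: rotation_system derived derived_rev derived_rot
    by (rule rotation_system_derived)
  fix p assume p: "p \<in> arcs derived"
  obtain u e where e: "u < N" "e \<in> arcs G" "p = lift u e"
    using p by (rule derived_arcE)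
  let ?d = "out_degree G (tail G e)" and ?w = "boundary_walk derived_rev derived_rot p"
  have w: "?w = map (\<lambda>i. (derived_face ^^ i) p) [0..<?d]"
    using e by (simp add: boundary_walk_def card_orbit_derived_face)
  have d: "3 \<le> ?d" using assms(1) e(2) by (rule out_degree_ge_3)
  have "derived_face q \<in> arcs derived \<and> tail derived (derived_face q) = head derived q"
    if q: "q \<in> arcs derived" for q
  proof -
    obtain v x where x: "v < N" "x \<in> arcs G" "q = lift v x"
      using q by (rule derived_arcE)
    then have "derived_face q = lift (snd q) (\<rho> x)" and "snd q < N"
      by (simp_all only: derived_face_lift) (simp_all add: lift_def shift_less)
    moreover have "lift (snd q) (\<rho> x) \<in> arcs derived" "fst (lift (snd q) (\<rho> x)) = snd q"
      using x \<open>snd q < N\<close> by (simp_all add: lift_in_arcs) (simp add: lift_def)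
    ultimately show ?thesis by simp
  qed
  from D.awalk_map_funpow[of derived_face, OF this p, of ?d]
  have walk: "D.awalk (fst p) ?w (fst p)"
    unfolding w using derived_face_period[OF e(1,2)] e(3) by simp
  have "distinct ?w"
    unfolding w using inj_on_derived_face[OF e(1,2)] e(3)
    by (simp add: distinct_map atLeast0LessThan)
  moreover have "set ?w = orbit derived_face p"
    unfolding w using orbit_derived_face[OF e(1,2)] e(3) by (simp add: atLeast0LessThan)
  ultimately have "distinct (map snd ?w)"
    using inj_on_snd_derived_face[OF e(1,2)] assms(2) e by (simp add: distinct_map)
  moreover have "?w \<noteq> []" unfolding w using d by auto
  \<comment> \<open>A cycle asks for distinct visited vertices after the initial one is dropped, and
    these are the heads of the arcs.\<close>
  moreover have "tl (D.awalk_verts (fst p) ?w) = map snd ?w"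
    using D.awalk_verts_conv'[of "fst p" ?w "fst p"] walk \<open>?w \<noteq> []\<close>
    by (simp add: D.awalk_def)
  ultimately have "D.cycle ?w" using walk unfolding D.cycle_def by metis
  then show "D.cycle ?w \<and> 3 \<le> length ?w" using d by (simp add: w)
qed

end

section \<open>Biregular graphs: the two face sizes at each edge\<close>

theorem theorem3p4:
  fixes m n s t :: nat
    and G :: "('a, 'b) pre_digraph"
    and \<tau> \<rho> :: "'b \<Rightarrow> 'b"
    and \<kappa> :: "'b \<Rightarrow> int"
  assumes "m > 0" "n > 0" "s > 0" "t > 0"
    and "biregular s t m n G"
    and "rotation_system G \<tau> \<rho>"
    and "monofacial G \<tau> \<rho>"
    and "unique_current_assignment (2 * m * s + 1) G \<tau> \<kappa>"
    and "kirchhoff_current_law (2 * m * s + 1) G \<kappa>"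
  shows "\<exists>(K :: (nat, nat \<times> nat) pre_digraph) \<tau>' \<rho>'.
    complete_digraph (2 * m * s + 1) K \<and>
    rotation_system K \<tau>' \<rho>' \<and>
    (\<forall>e \<in> arcs K. \<exists>F\<^sub>1 \<in> faces K \<tau>' \<rho>'. \<exists>F\<^sub>2 \<in> faces K \<tau>' \<rho>'.
       F\<^sub>1 \<noteq> F\<^sub>2 \<and>
       edge_on_face \<tau>' e F\<^sub>1 \<and> card F\<^sub>1 = s \<and>
       edge_on_face \<tau>' e F\<^sub>2 \<and> card F\<^sub>2 = t) \<and>
    ((\<forall>v \<in> verts G. simple_local_rotation (2 * m * s + 1) G \<rho> \<kappa> v) \<longrightarrow>
       faces_simple_cycles K \<tau>' \<rho>')"
proof -
  interpret rotation_system G \<tau> \<rho> by fact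
  have perm: "\<rho> \<circ> \<tau> permutes arcs G"
    using arev_permutes_arcs rotation_permutes by (rule permutes_compose)
  \<comment> \<open>Having one face means that all arcs have the same orbit; each lies on its own,
    so this orbit consists of all arcs.\<close>
  have "cyclic_on (\<rho> \<circ> \<tau>) (arcs G)"
  proof -
    obtain F where F: "faces G \<tau> \<rho> = {F}"
      using assms(7) unfolding monofacial_def by (auto simp: card_1_singleton_iff)
    then have "faces G \<tau> \<rho> \<noteq> {}" by simp
    then obtain e where e: "e \<in> arcs G" unfolding faces_def by auto
    have self: "x \<in> orbit (\<rho> \<circ> \<tau>) x" for x
    proof (rule permutation_self_in_orbit)
      show "permutation (\<rho> \<circ> \<tau>)"
        unfolding permutation_permutes using perm finite_arcs by blast
    qed
    have "orbit (\<rho> \<circ> \<tau>) x = F" if "x \<in> arcs G" for x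
    proof -
      have "orbit (\<rho> \<circ> \<tau>) x \<in> faces G \<tau> \<rho>" using that unfolding faces_def by (rule imageI)
      with F show ?thesis by simp
    qed
    then have "arcs G \<subseteq> orbit (\<rho> \<circ> \<tau>) e" using self e by blast
    moreover have "orbit (\<rho> \<circ> \<tau>) e \<subseteq> arcs G" using permutes_orbit_subset[OF perm e] .
    ultimately show ?thesis using e by (intro cyclic_on_singleI) auto
  qed
  then interpret current_graph G \<tau> \<rho> "2 * m * s + 1" \<kappa>
    using assms by unfold_locales
  obtain X Y where XY: "verts G = X \<union> Y" "X \<inter> Y = {}"
      "\<And>e. e \<in> arcs G \<Longrightarrow> tail G e \<in> X \<longleftrightarrow> head G e \<in> Y"
      "\<And>x. x \<in> X \<Longrightarrow> out_degree G x = s" "\<And>y. y \<in> Y \<Longrightarrow> out_degree G y = t"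
    using assms(5) unfolding biregular_def by blast
  \<comment> \<open>If the tail is outside \<open>X\<close>, the equivalence puts the head outside
    \<open>Y\<close>, hence in \<open>X\<close>.\<close>
  have bip: "tail G e \<in> X \<and> head G e \<in> Y \<or> tail G e \<in> Y \<and> head G e \<in> X" if "e \<in> arcs G" for e
    using XY(1) XY(3)[OF that] tail_in_verts[OF that] head_in_verts[OF that] by blast
  have loopfree: "tail G e \<noteq> head G e" if "e \<in> arcs G" for e
    using bip[OF that] XY(2) by auto
  have "\<exists>F\<^sub>1 \<in> faces derived derived_rev derived_rot. \<exists>F\<^sub>2 \<in> faces derived derived_rev derived_rot.
       F\<^sub>1 \<noteq> F\<^sub>2 \<and>
       edge_on_face derived_rev e F\<^sub>1 \<and> card F\<^sub>1 = s \<and>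
       edge_on_face derived_rev e F\<^sub>2 \<and> card F\<^sub>2 = t" if e: "e \<in> arcs derived" for e
  proof -
    let ?F = "orbit derived_face e" and ?F' = "orbit derived_face (derived_rev e)"
    obtain x where x: "x \<in> arcs G" "card ?F = out_degree G (tail G x)"
        "card ?F' = out_degree G (head G x)" "e \<in> ?F" "derived_rev e \<in> ?F'"
        "derived_rev e \<in> arcs derived" "?F \<noteq> ?F'"
      using derived_faces_of_edge[OF e] loopfree by blast
    have faces: "?F \<in> faces derived derived_rev derived_rot"
        "?F' \<in> faces derived derived_rev derived_rot"
      unfolding faces_def using e x by auto
    have on: "edge_on_face derived_rev e ?F" "edge_on_face derived_rev e ?F'"
      unfolding edge_on_face_def using x by auto
    \<comment> \<open>The face of size \<open>s\<close> belongs to the direction of \<open>e\<close>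
      whose label leaves a vertex of \<open>X\<close>.\<close>
    from bip[OF x(1)] show ?thesis
    proof
      assume "tail G x \<in> X \<and> head G x \<in> Y"
      then show ?thesis using x faces on XY(4,5) by (intro bexI[of _ ?F] bexI[of _ ?F']) auto
    next
      assume "tail G x \<in> Y \<and> head G x \<in> X"
      then show ?thesis using x faces on XY(4,5) by (intro bexI[of _ ?F'] bexI[of _ ?F]) auto
    qed
  qed
  then show ?thesis
    using complete_derived rotation_system_derived derived_faces_simple_cycles[OF loopfree]
    by (intro exI[of _ derived] exI[of _ derived_rev] exI[of _ derived_rot]) blast
qed

end
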